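(* Let $n \in \{8, 24, 32\}$ and let $C \subseteq \mathbb{F}_2^n$ be an extremal Type~II code of length $n$, with minimal nonzero weight $m$. Then $C$ is spanned (over $\mathbb{F}_2$) by its codewords of weight $m$, i.e. $C = \langle \{c \in C : \mathrm{wt}(c) = m\}\rangle$.
   Context: A (binary linear) code of length $n$ is a linear subspace of $\mathbb{F}_2^n$. The Hamming weight $\mathrm{wt}(c)$ is the number of coordinates $i$ with $c_i = 1$. The dual code is $C^\perp = \{c' \in \mathbb{F}_2^n : \sum_i c_i c'_i = 0 \text{ for all } c \in C\}$; $C$ is self-dual if $C = C^\perp$. A code is of Type~II if it is self-dual and doubly even, i.e. $4 \mid \mathrm{wt}(c)$ for all $c \in C$. A Type~II code of length $n$ is extremal if it has no nonzero codewords of weight less than $4\lfloor n/24\rfloor + 4$ (so its minimal nonzero weight is $4\lfloor n/24\rfloor+4$). *)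

theory Defs
  imports "HOL-Analysis.Cartesian_Space" "HOL-Library.Z2"
begin

text \<open>
  The field with two elements is the type \<open>bit\<close>, and the ambient space of length n is
  \<open>bit ^ 'n\<close> with \<open>CARD('n) = n\<close>. Subspaces and spans are those of the vector space
  structure over \<open>bit\<close>, i.e. \<open>vec.subspace\<close> and \<open>vec.span\<close>.
\<close>

definition hamming_weight :: "bit ^ 'n::finite \<Rightarrow> nat" where
  "hamming_weight c = card {i. c $ i = 1}"

definition dual_code :: "(bit ^ 'n::finite) set \<Rightarrow> (bit ^ 'n) set" where
  "dual_code C = {c'. \<forall>c\<in>C. (\<Sum>i\<in>UNIV. c $ i * c' $ i) = 0}"

definition linear_code :: "(bit ^ 'n::finite) set \<Rightarrow> bool" where
  "linear_code C \<longleftrightarrow> vec.subspace C"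

definition self_dual :: "(bit ^ 'n::finite) set \<Rightarrow> bool" where
  "self_dual C \<longleftrightarrow> C = dual_code C"

definition doubly_even :: "(bit ^ 'n::finite) set \<Rightarrow> bool" where
  "doubly_even C \<longleftrightarrow> (\<forall>c\<in>C. 4 dvd hamming_weight c)"

definition type_II_code :: "(bit ^ 'n::finite) set \<Rightarrow> bool" where
  "type_II_code C \<longleftrightarrow> linear_code C \<and> self_dual C \<and> doubly_even C"

definition extremal_type_II_code :: "(bit ^ 'n::finite) set \<Rightarrow> bool" where
  "extremal_type_II_code C \<longleftrightarrow> type_II_code C \<and>
     (\<forall>c\<in>C. c \<noteq> 0 \<longrightarrow> \<not> hamming_weight c < 4 * (CARD('n) div 24) + 4)"

text \<open>Only meaningful when \<open>C\<close> contains a nonzero word; a self-dual code of positive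
  length always does.\<close>

definition min_weight :: "(bit ^ 'n::finite) set \<Rightarrow> nat" where
  "min_weight C = Min (hamming_weight ` (C - {0}))"

end

theory Submission
  imports Defs "HOL-Computational_Algebra.Polynomial"
begin

text \<open>
  Let \<open>S\<close> be the span of the words of minimal weight \<open>d\<close>. As \<open>|S| |dual S| = 2^n\<close>,
  it suffices that every \<open>v\<close> orthogonal to all words of weight \<open>d\<close> lies in \<open>C\<close>.
  Let \<open>s w\<close> be the sum of the signs \<open>(-1)^(c \<cdot> v)\<close> over the words \<open>c\<close> of weight \<open>w\<close> in
  \<open>C\<close>. The MacWilliams identity, twisted by the character of \<open>v\<close>, expresses the numbers \<open>B j\<close>
  of words of weight \<open>j\<close> in the coset \<open>v + C\<close> linearly through the \<open>s w\<close>. Here \<open>s d\<close> is the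
  number of words of weight \<open>d\<close>, known from the case \<open>v = 0\<close>, and
  \<open>s (n - w) = \<plusminus> s w\<close> because the all-ones word is in \<open>C\<close>. If \<open>v\<close> is not in \<open>C\<close>, then
  \<open>B 0 = 0\<close>, and the few remaining unknowns can be eliminated: some \<open>B j\<close> turns out to be
  negative or a combination of them fails to be an integer.
\<close>

text \<open>Keeps \<open>+\<close> and \<open>*\<close> on \<open>bit\<close> as field operations,
  so that the ring laws apply.\<close>

declare add_bit_eq_xor [simp del] mult_bit_eq_and [simp del]

section \<open>Characters of the binary space\<close>

definition bit_sign :: "bit \<Rightarrow> int" where
  "bit_sign b = (if b = 0 then 1 else - 1)"

lemma bit_sign_0 [simp]: "bit_sign 0 = 1"
  by (simp add: bit_sign_def)

lemma bit_sign_1 [simp]: "bit_sign 1 = - 1"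
  by (simp add: bit_sign_def)

lemma bit_add_self [simp]: "(b :: bit) + b = 0"
  by (cases b) (auto simp: add_bit_eq_xor)

lemma bit_sign_add: "bit_sign (a + b) = bit_sign a * bit_sign b"
  by (cases a; cases b) auto

lemma bit_sign_sum: "bit_sign (sum f A) = (\<Prod>i\<in>A. bit_sign (f i))"
  by (induction A rule: infinite_finite_induct) (auto simp: bit_sign_add)

definition dot :: "bit ^ 'n::finite \<Rightarrow> bit ^ 'n \<Rightarrow> bit" where
  "dot c u = (\<Sum>i\<in>UNIV. c $ i * u $ i)"

lemma dot_commute: "dot c u = dot u c"
  by (simp add: dot_def mult.commute)

lemma dot_add_left: "dot (c + d) u = dot c u + dot d u"
  by (simp add: dot_def distrib_right sum.distrib)

lemma dot_add_right: "dot c (u + v) = dot c u + dot c v"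
  by (simp add: dot_def distrib_left sum.distrib)

lemma dot_0_left [simp]: "dot 0 u = 0"
  by (simp add: dot_def)

lemma dot_0_right [simp]: "dot c 0 = 0"
  by (simp add: dot_def)

lemma in_dual_code_iff: "u \<in> dual_code S \<longleftrightarrow> (\<forall>c\<in>S. dot c u = 0)"
  by (simp add: dual_code_def dot_def)

definition support :: "bit ^ 'n::finite \<Rightarrow> 'n set" where
  "support u = {i. u $ i = 1}"

lemma card_support: "card (support u) = hamming_weight u"
  by (simp add: support_def hamming_weight_def)

lemma bij_support: "bij (support :: bit ^ 'n::finite \<Rightarrow> 'n set)"
proof (rule bij_betw_byWitness[where f' = "\<lambda>T. \<chi> i. if i \<in> T then 1 else 0"])
  have "(\<chi> i. if i \<in> support u then 1 else 0) = u" for u :: "bit ^ 'n"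
    by (auto simp: support_def vec_eq_iff)
  then show "\<forall>u\<in>UNIV. (\<chi> i. if i \<in> support u then 1 else 0) = (u :: bit ^ 'n)"
    by blast
qed (auto simp: support_def)

lemma finite_words [simp]: "finite (S :: (bit ^ 'n::finite) set)"
proof -
  have "finite (UNIV :: (bit ^ 'n) set)"
    unfolding bij_betw_finite[OF bij_support] by simp
  then show ?thesis
    by (rule finite_subset[OF subset_UNIV])
qed

lemma CARD_bit [simp]: "CARD(bit) = 2"
proof -
  have "(UNIV :: bit set) = {0, 1}"
    using bit_not_one_iff by auto
  show ?thesis
    by (subst \<open>UNIV = {0, 1}\<close>) simp
qed

lemma word_add_self [simp]: "(c :: bit ^ 'n::finite) + c = 0"
  by (simp add: vec_eq_iff)

lemma word_add_self_left [simp]: "(c :: bit ^ 'n::finite) + (c + d) = d"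
  by (simp add: vec_eq_iff add.assoc[symmetric])

text \<open>Orthogonality of characters: translating by some \<open>d\<close> in \<open>S\<close>
  with \<open>dot d u = 1\<close> flips every sign, so the sum equals its own negative.\<close>

lemma sum_character:
  fixes S :: "(bit ^ 'n::finite) set"
  assumes "vec.subspace S"
  shows "(\<Sum>c\<in>S. bit_sign (dot c u)) = (if u \<in> dual_code S then int (card S) else 0)"
proof (cases "u \<in> dual_code S")
  case True
  then show ?thesis
    by (simp add: in_dual_code_iff)
next
  case False
  then obtain d where d: "d \<in> S" "dot d u = 1"
    by (auto simp: in_dual_code_iff)
  have "bij_betw ((+) d) S S"
    by (rule bij_betw_byWitness[where f' = "(+) d"])
      (use assms d(1) in \<open>auto intro: vec.subspace_add\<close>)
  then have "(\<Sum>c\<in>S. bit_sign (dot c u)) = (\<Sum>c\<in>S. bit_sign (dot (d + c) u))"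
    by (metis (no_types, lifting) sum.cong sum.reindex_bij_betw)
  also have "\<dots> = - (\<Sum>c\<in>S. bit_sign (dot c u))"
    by (simp add: dot_add_left bit_sign_add d sum_negf)
  finally show ?thesis
    using False by simp
qed

lemma dual_code_UNIV: "dual_code (UNIV :: (bit ^ 'n::finite) set) = {0}"
proof -
  have "u = 0" if "u \<in> dual_code UNIV" for u :: "bit ^ 'n"
  proof -
    have "dot (axis i 1) u = u $ i" for i
      by (simp add: dot_def axis_def if_distrib[of "\<lambda>x. x * _"] cong: if_cong)
    with that show ?thesis
      by (simp add: in_dual_code_iff vec_eq_iff)
  qed
  then show ?thesis
    by (auto simp: in_dual_code_iff)
qed

text \<open>Double counting of the signs over all pairs of a word in \<open>S\<close> and a word of
  the space: each order of summation is evaluated by \<open>sum_character\<close>.\<close>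

lemma card_dual_code:
  fixes S :: "(bit ^ 'n::finite) set"
  assumes "vec.subspace S"
  shows "card S * card (dual_code S) = 2 ^ CARD('n)"
proof -
  have "int (card S * card (dual_code S)) = (\<Sum>u\<in>UNIV. if u \<in> dual_code S then int (card S) else 0)"
    by (simp add: sum.If_cases)
  also have "\<dots> = (\<Sum>u\<in>UNIV. \<Sum>c\<in>S. bit_sign (dot c u))"
    by (simp add: sum_character[OF assms])
  also have "\<dots> = (\<Sum>c\<in>S. \<Sum>u\<in>UNIV. bit_sign (dot u c))"
    by (subst sum.swap) (simp add: dot_commute)
  also have "\<dots> = (\<Sum>c\<in>S. if c = 0 then 2 ^ CARD('n) else 0)"
    by (subst sum_character) (simp_all add: dual_code_UNIV)
  also have "\<dots> = 2 ^ CARD('n)"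
    using vec.subspace_0[OF assms] by simp
  finally show ?thesis
    by (metis of_nat_eq_iff of_nat_numeral of_nat_power)
qed

section \<open>Krawtchouk numbers and weight identities\<close>

text \<open>The value at \<open>w\<close> of the Krawtchouk polynomial of degree \<open>j\<close>;
  \<open>i\<close> counts the chosen positions inside a support of size \<open>w\<close>.\<close>

definition krawtchouk :: "nat \<Rightarrow> nat \<Rightarrow> nat \<Rightarrow> int" where
  "krawtchouk n j w = (\<Sum>i\<le>j. (- 1) ^ i * int (w choose i) * int ((n - w) choose (j - i)))"

text \<open>With a list in place of a set, the sum unfolds by rewriting once the arguments are
  numerals.\<close>

lemma krawtchouk_eq_sum_list:
  "krawtchouk n j w = (\<Sum>i\<leftarrow>[0..<Suc j]. (- 1) ^ i * int (w choose i) * int ((n - w) choose (j - i)))"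
  by (simp only: krawtchouk_def interv_sum_list_conv_sum_set_nat atLeast0LessThan
      lessThan_Suc_atMost[symmetric] set_upt)

lemma binomial_fact_div:
  "n choose k = (if k \<le> n then fact n div (fact k * fact (n - k)) else 0)"
  by (simp add: binomial_fact' binomial_eq_0)

lemmas krawtchouk_eval = krawtchouk_eq_sum_list binomial_fact_div upt_rec fact_numeral

lemma coeff_krawtchouk:
  "coeff ([:1, - 1:] ^ w * [:1, 1:] ^ (n - w)) j = krawtchouk n j w"
proof -
  have "coeff ([:1, a:] ^ m) i = int (m choose i) * a ^ i" for a :: int and m i
  proof (cases "i \<le> m")
    case True
    then show ?thesis
      by (simp add: coeff_linear_poly_power)
  next
    case False
    then have "degree ([:1, a:] ^ m) < i"
      using degree_power_le[of "[:1, a:]" m] by (simp split: if_splits)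
    with False show ?thesis
      by (simp add: coeff_eq_0 binomial_eq_0)
  qed
  then show ?thesis
    by (simp add: krawtchouk_def coeff_mult mult_ac)
qed

text \<open>Generating function: expanding the product of \<open>1 + (-1)^(c_i) X\<close> over the
  coordinates yields one signed monomial for each support, and the same product is
  \<open>(1 - X)^w (1 + X)^(n - w)\<close> with \<open>w\<close> the weight of
  \<open>c\<close>.\<close>

lemma sum_character_weight:
  fixes c :: "bit ^ 'n::finite"
  shows "(\<Sum>u | hamming_weight u = j. bit_sign (dot c u)) = krawtchouk CARD('n) j (hamming_weight c)"
proof -
  define f where "f i = [:0, bit_sign (c $ i):]" for i
  have f: "prod f T = monom (\<Prod>i\<in>T. bit_sign (c $ i)) (card T)" if "finite T" for T
    using that
    by (induction T) (auto simp: f_def mult_monom monom_altdef mult.commute)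
  have dot: "bit_sign (dot c u) = (\<Prod>i\<in>support u. bit_sign (c $ i))" for u
  proof -
    have "(\<Prod>i\<in>UNIV. bit_sign (c $ i * u $ i)) = (\<Prod>i\<in>UNIV. if i \<in> support u then bit_sign (c $ i) else 1)"
      by (intro prod.cong) (auto simp: support_def)
    then show ?thesis
      by (simp add: dot_def bit_sign_sum prod.If_cases)
  qed
  have "(\<Prod>i\<in>UNIV. f i + 1) = (\<Prod>i\<in>UNIV. if i \<in> support c then [:1, - 1:] else [:1, 1 :: int:])"
    by (intro prod.cong) (auto simp: f_def support_def one_pCons)
  also have "\<dots> = [:1, - 1:] ^ hamming_weight c * [:1, 1:] ^ (CARD('n) - hamming_weight c)"
    by (simp add: prod.If_cases card_support card_Diff_subset flip: Compl_eq_Diff_UNIV)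
      (simp add: Compl_eq_Diff_UNIV card_Diff_subset card_support)
  finally have "krawtchouk CARD('n) j (hamming_weight c) = coeff (\<Prod>i\<in>UNIV. f i + 1) j"
    by (simp add: coeff_krawtchouk)
  \<comment> \<open>Choosing \<open>f i\<close> or 1 in each factor amounts to choosing a set
    \<open>T\<close> of coordinates.\<close>
  also have "\<dots> = (\<Sum>T\<in>UNIV. coeff (prod f T) j)"
    by (subst prod_add) (simp_all add: coeff_sum)
  also have "\<dots> = (\<Sum>u\<in>UNIV. coeff (prod f (support u)) j)"
    by (rule sum.reindex_bij_betw[OF bij_support, symmetric])
  also have "\<dots> = (\<Sum>u\<in>UNIV. if hamming_weight u = j then bit_sign (dot c u) else 0)"
    by (intro sum.cong) (auto simp: f dot card_support)
  finally show ?thesis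
    by (simp add: sum.If_cases)
qed

section \<open>Signed weight counts of a code and weight counts of its cosets\<close>

definition signed_count :: "(bit ^ 'n::finite) set \<Rightarrow> bit ^ 'n \<Rightarrow> nat \<Rightarrow> int" where
  "signed_count C v w = (\<Sum>c | c \<in> C \<and> hamming_weight c = w. bit_sign (dot c v))"

text \<open>In characteristic 2 the condition \<open>u + v \<in> C\<close> says that
  \<open>u\<close> lies in the coset of \<open>v\<close>.\<close>

definition coset_count :: "(bit ^ 'n::finite) set \<Rightarrow> bit ^ 'n \<Rightarrow> nat \<Rightarrow> nat" where
  "coset_count C v j = card {u. hamming_weight u = j \<and> u + v \<in> C}"

lemma hamming_weight_eq_0_iff [simp]: "hamming_weight c = 0 \<longleftrightarrow> c = 0"
  by (auto simp: hamming_weight_def vec_eq_iff)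

lemma hamming_weight_0 [simp]: "hamming_weight 0 = 0"
  by simp

lemma hamming_weight_le: "hamming_weight (c :: bit ^ 'n::finite) \<le> CARD('n)"
  by (simp add: hamming_weight_def card_mono)

lemma hamming_weight_add_le: "hamming_weight (c + d) \<le> hamming_weight c + hamming_weight d"
proof -
  have "support (c + d) \<subseteq> support c \<union> support d"
    by (auto simp: support_def)
  then have "card (support (c + d)) \<le> card (support c \<union> support d)"
    by (simp add: card_mono)
  also have "\<dots> \<le> card (support c) + card (support d)"
    by (rule card_Un_le)
  finally show ?thesis
    by (simp add: card_support)
qed

lemma support_complement: "support (c + 1) = - support c"
proof -
  have "b + 1 = 1 \<longleftrightarrow> b \<noteq> 1" for b :: bit
    by (cases b) auto
  then show ?thesis
    by (auto simp: support_def)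
qed

lemma hamming_weight_complement:
  "hamming_weight ((c :: bit ^ 'n::finite) + 1) = CARD('n) - hamming_weight c"
  by (simp add: support_complement Compl_eq_Diff_UNIV card_Diff_subset flip: card_support)

lemma dot_1_right: "dot c 1 = of_nat (hamming_weight c)"
proof -
  have "dot c 1 = (\<Sum>i\<in>UNIV. if i \<in> support c then 1 else 0)"
    unfolding dot_def by (intro sum.cong) (auto simp: support_def)
  then show ?thesis
    by (simp add: sum.If_cases card_support)
qed

text \<open>Two words of weight \<open>j\<close> in one coset differ by a codeword of weight at most
  \<open>2 * j\<close>.\<close>

lemma coset_count_le_1:
  assumes C: "vec.subspace C" and min: "\<And>c. c \<in> C \<Longrightarrow> c \<noteq> 0 \<Longrightarrow> 2 * j < hamming_weight c"
  shows "coset_count C v j \<le> 1"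
proof -
  have "u = u'" if "hamming_weight u = j" "u + v \<in> C" "hamming_weight u' = j" "u' + v \<in> C" for u u'
  proof (rule ccontr)
    assume "u \<noteq> u'"
    have "u + u' = (u + v) + (u' + v)"
      by (metis add.assoc add.commute word_add_self_left)
    with that C have "u + u' \<in> C"
      by (metis vec.subspace_add)
    moreover have "u + u' \<noteq> 0"
      using \<open>u \<noteq> u'\<close> by (metis add.right_neutral word_add_self_left)
    ultimately have "2 * j < hamming_weight (u + u')"
      by (rule min)
    with hamming_weight_add_le[of u u'] that show False
      by simp
  qed
  then show ?thesis
    unfolding coset_count_def by (intro card_le_Suc0_iff_eq[THEN iffD2, folded One_nat_def]) auto
qed

text \<open>Supplies the vanishing equations that determine the number of words of minimal
  weight.\<close>

lemma coset_count_0_eq_0: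
  assumes "\<And>c. c \<in> C \<Longrightarrow> c \<noteq> 0 \<Longrightarrow> j < hamming_weight c" "j \<noteq> 0"
  shows "coset_count C 0 j = 0"
  using assms by (fastforce simp: coset_count_def)

lemma coset_count_weight_0: "coset_count C v 0 = of_bool (v \<in> C)"
proof -
  have "{u. hamming_weight u = 0 \<and> u + v \<in> C} = (if v \<in> C then {0} else {})"
    by auto
  then show ?thesis
    by (simp add: coset_count_def)
qed

lemma signed_count_weight_0:
  assumes "vec.subspace C"
  shows "signed_count C v 0 = 1"
proof -
  have "{c. c \<in> C \<and> hamming_weight c = 0} = {0}"
    using vec.subspace_0[OF assms] by auto
  then show ?thesis
    by (simp add: signed_count_def)
qed

text \<open>The MacWilliams identity, twisted by the character of \<open>v\<close>.\<close>

lemma sum_signed_count_krawtchouk: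
  fixes C :: "(bit ^ 'n::finite) set"
  assumes C: "vec.subspace C" and dual: "dual_code C = C"
    and W: "finite W" "hamming_weight ` C \<subseteq> W"
  shows "(\<Sum>w\<in>W. krawtchouk CARD('n) j w * signed_count C v w) = int (card C) * int (coset_count C v j)"
proof -
  have "(\<Sum>w\<in>W. krawtchouk CARD('n) j w * signed_count C v w)
      = (\<Sum>w\<in>W. \<Sum>c | c \<in> C \<and> hamming_weight c = w.
          krawtchouk CARD('n) j (hamming_weight c) * bit_sign (dot c v))"
    by (simp add: signed_count_def sum_distrib_left)
  also have "\<dots> = (\<Sum>c\<in>C. krawtchouk CARD('n) j (hamming_weight c) * bit_sign (dot c v))"
    by (rule sum.group) (use W in auto)
  \<comment> \<open>Each Krawtchouk number becomes a sum of signs; after the swap, the sum over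
    \<open>C\<close> detects membership of \<open>u + v\<close> in the dual, which is
    \<open>C\<close>.\<close>
  also have "\<dots> = (\<Sum>c\<in>C. \<Sum>u | hamming_weight u = j. bit_sign (dot c (u + v)))"
    by (simp add: sum_distrib_right dot_add_right bit_sign_add flip: sum_character_weight)
  also have "\<dots> = (\<Sum>u | hamming_weight u = j. \<Sum>c\<in>C. bit_sign (dot c (u + v)))"
    by (rule sum.swap)
  also have "\<dots> = (\<Sum>u | hamming_weight u = j. if u + v \<in> C then int (card C) else 0)"
    by (simp add: sum_character[OF C] dual)
  also have "\<dots> = int (card C) * int (coset_count C v j)"
    by (simp add: sum.If_cases coset_count_def Int_def)
  finally show ?thesis .
qed

text \<open>Adding the all-ones word exchanges the weights \<open>w\<close> and \<open>n - w\<close>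
  and multiplies each sign by that of \<open>dot 1 v\<close>.\<close>

lemma signed_count_complement:
  fixes C :: "(bit ^ 'n::finite) set"
  assumes C: "vec.subspace C" and one: "1 \<in> C" and w: "w \<le> CARD('n)"
  shows "signed_count C v (CARD('n) - w) = bit_sign (dot 1 v) * signed_count C v w"
proof -
  have "bij_betw (\<lambda>c. c + 1) {c. c \<in> C \<and> hamming_weight c = w}
          {c. c \<in> C \<and> hamming_weight c = CARD('n) - w}"
    by (rule bij_betw_byWitness[where f' = "\<lambda>c. c + 1"])
      (use w one C in \<open>auto simp: hamming_weight_complement add.assoc intro: vec.subspace_add\<close>)
  then have "signed_count C v (CARD('n) - w) = (\<Sum>c | c \<in> C \<and> hamming_weight c = w. bit_sign (dot (c + 1) v))"
    unfolding signed_count_def by (rule sum.reindex_bij_betw[symmetric])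
  then show ?thesis
    by (simp add: signed_count_def dot_add_left bit_sign_add sum_distrib_left mult.commute)
qed

lemma signed_count_cong_orthogonal:
  assumes "\<And>c. c \<in> C \<Longrightarrow> hamming_weight c = w \<Longrightarrow> dot c v = 0"
  shows "signed_count C v w = signed_count C 0 w"
  using assms by (simp add: signed_count_def)

section \<open>Extremal codes\<close>

text \<open>All weights are even, so the all-ones word is orthogonal to \<open>C\<close>.\<close>

lemma type_II_code_one:
  fixes C :: "(bit ^ 'n::finite) set"
  assumes "type_II_code C"
  shows "1 \<in> C"
proof -
  have "dot c 1 = 0" if "c \<in> C" for c
  proof -
    have "even (hamming_weight c)"
      using assms that unfolding type_II_code_def doubly_even_def
      by (meson dvd_trans even_numeral)
    then obtain k where "hamming_weight c = k + k"
      by (metis mult_2 evenE)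
    then show ?thesis
      by (simp add: dot_1_right)
  qed
  then have "1 \<in> dual_code C"
    by (simp add: in_dual_code_iff)
  with assms show ?thesis
    by (simp add: type_II_code_def self_dual_def)
qed

text \<open>The hypothesis \<open>orth\<close> puts the dual of the span inside \<open>C\<close>.
  Since the span and its dual have sizes with product \<open>card C * card C\<close>, the span is at
  least as large as \<open>C\<close>.\<close>

lemma span_eq_of_orthogonal:
  fixes C :: "(bit ^ 'n::finite) set"
  assumes C: "vec.subspace C" "dual_code C = C" and M: "M \<subseteq> C"
    and orth: "\<And>v. (\<And>c. c \<in> M \<Longrightarrow> dot c v = 0) \<Longrightarrow> v \<in> C"
  shows "vec.span M = C"
proof (rule card_subset_eq)
  show sub: "vec.span M \<subseteq> C"
    using C(1) M by (rule vec.span_minimal[rotated])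
  have "dual_code (vec.span M) \<subseteq> C"
    using orth by (auto simp: in_dual_code_iff vec.span_base)
  then have "card (dual_code (vec.span M)) \<le> card C"
    by (simp add: card_mono)
  then have "card (vec.span M) * card (dual_code (vec.span M)) \<le> card (vec.span M) * card C"
    by simp
  moreover have "card (vec.span M) * card (dual_code (vec.span M)) = card C * card C"
    using card_dual_code[OF vec.subspace_span] card_dual_code[OF C(1)] C(2) by metis
  moreover have "card C > 0"
    using vec.subspace_0[OF C(1)] by (auto simp: card_gt_0_iff)
  ultimately have "card C \<le> card (vec.span M)"
    by simp
  then show "card (vec.span M) = card C"
    using card_mono[OF finite_words sub] by simp
qed simp

locale extremal_code =
  fixes C :: "(bit ^ 'n::finite) set"
  assumes extremal: "extremal_type_II_code C"
begin

lemma type_II: "type_II_code C"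
  using extremal by (simp add: extremal_type_II_code_def)

lemma subspace: "vec.subspace C"
  using type_II by (simp add: type_II_code_def linear_code_def)

lemma dual: "dual_code C = C"
  using type_II by (simp add: type_II_code_def self_dual_def)

lemma one: "1 \<in> C"
  using type_II by (rule type_II_code_one)

lemma dvd_weight: "c \<in> C \<Longrightarrow> 4 dvd hamming_weight c"
  using type_II by (simp add: type_II_code_def doubly_even_def)

lemma weight_lower:
  assumes "c \<in> C" "hamming_weight c \<noteq> 0"
  shows "4 * (CARD('n) div 24) + 4 \<le> hamming_weight c"
  using extremal assms by (auto simp: extremal_type_II_code_def not_less)

text \<open>The lower bound, applied to the complement \<open>c + 1\<close>.\<close>

lemma weight_upper:
  assumes "c \<in> C"
  shows "hamming_weight c = CARD('n) \<or> hamming_weight c + (4 * (CARD('n) div 24) + 4) \<le> CARD('n)"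
proof -
  have "c + 1 \<in> C"
    using assms one subspace by (simp add: vec.subspace_add)
  from weight_lower[OF this] show ?thesis
    using hamming_weight_le[of c]
    by (cases "hamming_weight c = CARD('n)") (simp_all add: hamming_weight_complement)
qed

lemma card_code:
  assumes "CARD('n) = 2 * k"
  shows "card C = 2 ^ k"
proof -
  have "(card C)\<^sup>2 = (2 ^ k)\<^sup>2"
    using card_dual_code[OF subspace] assms by (simp add: dual power2_eq_square mult_2 power_add)
  then show ?thesis
    by simp
qed

lemma macwilliams:
  assumes "finite W" "hamming_weight ` C \<subseteq> W"
  shows "(\<Sum>w\<in>W. krawtchouk CARD('n) j w * signed_count C v w) = int (card C) * int (coset_count C v j)"
  using sum_signed_count_krawtchouk[OF subspace dual assms] .

text \<open>Reduces the theorem to signed counts: \<open>pos\<close> ensures that \<open>d\<close>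
  really is the minimal weight, and orthogonality to the words of weight \<open>d\<close> enters
  only through the value of \<open>signed_count C v d\<close>.\<close>

lemma span_min_words:
  assumes pos: "signed_count C 0 d > 0" and d: "d = 4 * (CARD('n) div 24) + 4"
    and orth: "\<And>v. signed_count C v d = signed_count C 0 d \<Longrightarrow> v \<in> C"
  shows "C = vec.span {c \<in> C. hamming_weight c = min_weight C}"
proof -
  have "{c. c \<in> C \<and> hamming_weight c = d} \<noteq> {}"
    using pos by (auto simp: signed_count_def simp del: Collect_empty_eq)
  then obtain c where c: "c \<in> C" "hamming_weight c = d"
    by blast
  have "min_weight C = d"
    unfolding min_weight_def
  proof (rule Min_eqI)
    show "d \<le> w" if "w \<in> hamming_weight ` (C - {0})" for w
      using that weight_lower unfolding d by auto
    show "d \<in> hamming_weight ` (C - {0})"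
      using c d by force
  qed simp
  moreover have "vec.span {c \<in> C. hamming_weight c = d} = C"
    by (rule span_eq_of_orthogonal[OF subspace dual])
      (auto intro: orth signed_count_cong_orthogonal)
  ultimately show ?thesis
    by simp
qed

lemma signed_count_0: "signed_count C v 0 = 1"
  using subspace by (rule signed_count_weight_0)

lemma complement:
  "w \<le> CARD('n) \<Longrightarrow> signed_count C v (CARD('n) - w) = bit_sign (dot 1 v) * signed_count C v w"
  using subspace one by (rule signed_count_complement)

section \<open>The lengths 8, 24 and 32\<close>

lemma span_min_words_8:
  assumes n: "CARD('n) = 8"
  shows "C = vec.span {c \<in> C. hamming_weight c = min_weight C}"
proof (rule span_min_words)
  have W: "hamming_weight ` C \<subseteq> {0, 4, 8}"
  proof
    fix w assume "w \<in> hamming_weight ` C"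
    then obtain c where c: "c \<in> C" "w = hamming_weight c"
      by blast
    then show "w \<in> {0, 4, 8}"
      using weight_lower[of c] weight_upper[of c] n by auto
  qed
  have card: "card C = 16"
    using card_code[of 4] n by simp
  have K: "krawtchouk 8 0 0 = 1" "krawtchouk 8 0 4 = 1" "krawtchouk 8 0 8 = 1"
    by (simp_all add: krawtchouk_eval)
  have eq: "1 + signed_count C v 4 + bit_sign (dot 1 v) = 16 * of_bool (v \<in> C)" for v
    using macwilliams[OF _ W, of 0 v] complement[of 0 v] n K card
    by (simp add: signed_count_0 coset_count_weight_0)
  have A: "signed_count C 0 4 = 14"
    using eq[of 0] vec.subspace_0[OF subspace] by simp
  then show "signed_count C 0 4 > 0"
    by simp
  \<comment> \<open>For \<open>v\<close> outside \<open>C\<close> the identity \<open>eq\<close>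
    would read 1 + 14 + 1 = 0 or 1 + 14 - 1 = 0.\<close>
  show "v \<in> C" if "signed_count C v 4 = signed_count C 0 4" for v
    using eq[of v] that A by (cases "v \<in> C") (auto simp: bit_sign_def split: if_splits)
qed (simp add: n)

text \<open>Codewords have even weight, so the weights in the coset of \<open>v\<close> all have the
  parity given by \<open>dot 1 v\<close>. Hence even \<open>j\<close> are used when
  \<open>dot 1 v = 0\<close> and an odd \<open>j\<close> otherwise.\<close>

lemma span_min_words_24:
  assumes n: "CARD('n) = 24"
  shows "C = vec.span {c \<in> C. hamming_weight c = min_weight C}"
proof (rule span_min_words)
  have W: "hamming_weight ` C \<subseteq> {0, 8, 12, 16, 24}"
  proof
    fix w assume "w \<in> hamming_weight ` C"
    then obtain c where c: "c \<in> C" "w = hamming_weight c"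
      by blast
    with dvd_weight[of c] obtain k where k: "w = 4 * k"
      by blast
    then show "w \<in> {0, 8, 12, 16, 24}"
      using weight_lower[of c] weight_upper[of c] n c by simp presburger
  qed
  have card: "card C = 4096"
    using card_code[of 12] n by simp
  have K: "krawtchouk 24 0 0 = 1" "krawtchouk 24 0 8 = 1" "krawtchouk 24 0 12 = 1"
      "krawtchouk 24 0 16 = 1" "krawtchouk 24 0 24 = 1"
      "krawtchouk 24 1 0 = 24" "krawtchouk 24 1 8 = 8" "krawtchouk 24 1 12 = 0"
      "krawtchouk 24 1 16 = - 8" "krawtchouk 24 1 24 = - 24"
      "krawtchouk 24 2 0 = 276" "krawtchouk 24 2 8 = 20" "krawtchouk 24 2 12 = - 12"
      "krawtchouk 24 2 16 = 20" "krawtchouk 24 2 24 = 276"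
      "krawtchouk 24 4 0 = 10626" "krawtchouk 24 4 8 = - 126" "krawtchouk 24 4 12 = 66"
      "krawtchouk 24 4 16 = - 126" "krawtchouk 24 4 24 = 10626"
    by (simp_all add: krawtchouk_eval)
  have sym: "signed_count C v 24 = bit_sign (dot 1 v)"
      "signed_count C v 16 = bit_sign (dot 1 v) * signed_count C v 8" for v
    using complement[of 0 v] complement[of 8 v] n by (simp_all add: signed_count_0)
  note mac = macwilliams[OF _ W, unfolded n card, simplified, unfolded signed_count_0 sym]
  have A: "signed_count C 0 8 = 759"
  proof -
    \<comment> \<open>The minimal weight is 8; the equations for \<open>j = 0\<close> and
      \<open>j = 2\<close> then determine the two unknown counts, at weights 8 and 12.\<close>
    have "coset_count C 0 2 = 0"
      using weight_lower n by (intro coset_count_0_eq_0) force+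
    then show ?thesis
      using mac[of 0 0] mac[of 2 0] vec.subspace_0[OF subspace]
      by (simp add: K coset_count_weight_0)
  qed
  then show "signed_count C 0 8 > 0"
    by simp
  show "v \<in> C" if "signed_count C v 8 = signed_count C 0 8" for v
  proof (rule ccontr)
    assume "v \<notin> C"
    show False
    proof (cases "dot 1 v = 0")
      case True
      \<comment> \<open>The equation for \<open>j = 0\<close> forces the signed count at weight 12
        to be -1520, which makes the one for \<open>j = 4\<close> negative.\<close>
      then have "4096 * int (coset_count C v 4) < 0"
        using mac[of 0 v] mac[of 4 v] \<open>v \<notin> C\<close> that A by (simp add: K coset_count_weight_0)
      then show False
        by simp
    next
      case False
      \<comment> \<open>The unknown at weight 12 drops out because its Krawtchouk number for
        \<open>j = 1\<close> is 0.\<close>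
      then have "4096 * int (coset_count C v 1) = 12192"
        using mac[of 1 v] that A by (simp add: K[simplified])
      then have "(4096 :: int) dvd 12192"
        by (metis dvd_triv_left)
      then show False
        by simp
    qed
  qed
qed (simp add: n)

lemma span_min_words_32:
  assumes n: "CARD('n) = 32"
  shows "C = vec.span {c \<in> C. hamming_weight c = min_weight C}"
proof (rule span_min_words)
  have W: "hamming_weight ` C \<subseteq> {0, 8, 12, 16, 20, 24, 32}"
  proof
    fix w assume "w \<in> hamming_weight ` C"
    then obtain c where c: "c \<in> C" "w = hamming_weight c"
      by blast
    with dvd_weight[of c] obtain k where k: "w = 4 * k"
      by blast
    then show "w \<in> {0, 8, 12, 16, 20, 24, 32}"
      using weight_lower[of c] weight_upper[of c] n c by simp presburger
  qed
  have card: "card C = 65536"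
    using card_code[of 16] n by simp
  have K: "krawtchouk 32 0 0 = 1" "krawtchouk 32 0 8 = 1" "krawtchouk 32 0 12 = 1"
      "krawtchouk 32 0 16 = 1" "krawtchouk 32 0 20 = 1" "krawtchouk 32 0 24 = 1"
      "krawtchouk 32 0 32 = 1"
      "krawtchouk 32 1 0 = 32" "krawtchouk 32 1 8 = 16" "krawtchouk 32 1 12 = 8"
      "krawtchouk 32 1 16 = 0" "krawtchouk 32 1 20 = - 8" "krawtchouk 32 1 24 = - 16"
      "krawtchouk 32 1 32 = - 32"
      "krawtchouk 32 2 0 = 496" "krawtchouk 32 2 8 = 112" "krawtchouk 32 2 12 = 16"
      "krawtchouk 32 2 16 = - 16" "krawtchouk 32 2 20 = 16" "krawtchouk 32 2 24 = 112"
      "krawtchouk 32 2 32 = 496"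
      "krawtchouk 32 3 0 = 4960" "krawtchouk 32 3 8 = 432" "krawtchouk 32 3 12 = - 40"
      "krawtchouk 32 3 16 = 0" "krawtchouk 32 3 20 = 40" "krawtchouk 32 3 24 = - 432"
      "krawtchouk 32 3 32 = - 4960"
      "krawtchouk 32 4 0 = 35960" "krawtchouk 32 4 8 = 888" "krawtchouk 32 4 12 = - 200"
      "krawtchouk 32 4 16 = 120" "krawtchouk 32 4 20 = - 200" "krawtchouk 32 4 24 = 888"
      "krawtchouk 32 4 32 = 35960"
      "krawtchouk 32 6 0 = 906192" "krawtchouk 32 6 8 = - 3248" "krawtchouk 32 6 12 = 816"
      "krawtchouk 32 6 16 = - 560" "krawtchouk 32 6 20 = 816" "krawtchouk 32 6 24 = - 3248"
      "krawtchouk 32 6 32 = 906192"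
    by (simp_all add: krawtchouk_eval)
  have sym: "signed_count C v 32 = bit_sign (dot 1 v)"
      "signed_count C v 24 = bit_sign (dot 1 v) * signed_count C v 8"
      "signed_count C v 20 = bit_sign (dot 1 v) * signed_count C v 12" for v
    using complement[of 0 v] complement[of 8 v] complement[of 12 v] n
    by (simp_all add: signed_count_0)
  note mac = macwilliams[OF _ W, unfolded n card, simplified, unfolded signed_count_0 sym]
  have A: "signed_count C 0 8 = 620"
  proof -
    \<comment> \<open>Three unknowns, at weights 8, 12 and 16, call for the three equations
      \<open>j = 0, 2, 4\<close>.\<close>
    have "coset_count C 0 2 = 0" "coset_count C 0 4 = 0"
      using weight_lower n by (intro coset_count_0_eq_0; force)+
    then show ?thesis
      using mac[of 0 0] mac[of 2 0] mac[of 4 0] vec.subspace_0[OF subspace]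
      by (simp add: K coset_count_weight_0)
  qed
  then show "signed_count C 0 8 > 0"
    by simp
  show "v \<in> C" if "signed_count C v 8 = signed_count C 0 8" for v
  proof (rule ccontr)
    assume "v \<notin> C"
    show False
    proof (cases "dot 1 v = 0")
      case True
      have "coset_count C v 2 \<le> 1"
        using weight_lower n by (intro coset_count_le_1 subspace) force
      \<comment> \<open>The equations for \<open>j = 0\<close> and \<open>j = 2\<close> express the
        unknowns at weights 12 and 16 through \<open>coset_count C v 2\<close>. As this is at most
        1, the right-hand side is negative.\<close>
      moreover have "int (coset_count C v 6) = 43 * int (coset_count C v 2) - 128"
        using True mac[of 0 v] mac[of 2 v] mac[of 6 v] \<open>v \<notin> C\<close> that A
        by (simp add: K coset_count_weight_0)
      ultimately show False
        by linarith
    next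
      case False
      \<comment> \<open>The Krawtchouk numbers at weight 16 vanish for \<open>j = 1\<close> and
        \<open>j = 3\<close>, and the factor 5 cancels the unknown at weight 12, where they are 8
        and -40. A common factor 2 is divided out.\<close>
      then have "32768 * (int (coset_count C v 3) + 5 * int (coset_count C v 1)) = 322560"
        using mac[of 1 v] mac[of 3 v] that A by (simp add: K[simplified])
      then have "(32768 :: int) dvd 322560"
        by (metis dvd_triv_left)
      then show False
        by simp
    qed
  qed
qed (simp add: n)

end

theorem theorem3p3:
  fixes C :: "(bit ^ 'n::finite) set" and m :: nat
  assumes "CARD('n) \<in> {8, 24, 32}"
    and "extremal_type_II_code C"
    and "m = min_weight C"
  shows "C = vec.span {c \<in> C. hamming_weight c = m}"
proof -
  interpret extremal_code C
    by standard (rule assms(2))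
  show ?thesis
    using assms(1,3) span_min_words_8 span_min_words_24 span_min_words_32 by auto
qed

end
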